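(* Every topological space $X$ has a universal lpc-space $\pi\colon lpc(X)\to X$. The space $lpc(X)$ is homeomorphic to the set $X$ equipped with a new topology, namely the one generated by all path-components of all open subsets of the existing topology of $X$.
   Context: An lpc-space is a locally path-connected topological space. Maps are continuous. A universal lpc-space of a topological space $X$ is an lpc-space $lpc(X)$ together with a continuous map $\pi\colon lpc(X)\to X$ such that for any map $f\colon Y\to X$ from an lpc-space $Y$ there is a unique continuous map $g\colon Y\to lpc(X)$ with $\pi\circ g=f$. *)

theory Defs
  imports "HOL-Analysis.Analysis"
begin

text \<open>
  The universal property quantifies over all lpc-spaces \<open>Y\<close>. A HOL formula cannot quantify over
  types, so the point type \<open>'b\<close> of the test spaces \<open>Y\<close> is a parameter of the predicate; the full
  universal property is the predicate for every \<open>'b\<close>. As a hypothesis, any single instance is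
  implied by the full property.
  The lift is a map on the carrier of \<open>Y\<close>, represented by its extensional
  representative, so that uniqueness does not concern the values outside \<open>topspace Y\<close>.
\<close>

definition universal_lpc_space ::
  "'b itself \<Rightarrow> 'a topology \<Rightarrow> 'c topology \<Rightarrow> ('c \<Rightarrow> 'a) \<Rightarrow> bool" where
  "universal_lpc_space (_ :: 'b itself) X L p \<longleftrightarrow>
     locally_path_connected_space L \<and>
     continuous_map L X p \<and>
     (\<forall>(Y :: 'b topology) f.
        locally_path_connected_space Y \<and> continuous_map Y X f \<longrightarrow>
        (\<exists>!g. g \<in> extensional (topspace Y) \<and> continuous_map Y L g \<and>
              (\<forall>y \<in> topspace Y. p (g y) = f y)))"

definition lpc_topology :: "'a topology \<Rightarrow> 'a topology" where
  "lpc_topology X =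
     topology_generated_by (\<Union>U \<in> {U. openin X U}. path_components_of (subtopology X U))"

end

theory Submission
  imports Defs
begin

text \<open>
  Two observations carry the proof. The subbase defining \<^term>\<open>lpc_topology X\<close> is in effect
  a base (\<open>openin_lpc_topology_iff\<close>): if \<open>x\<close> lies in path-components of the open sets \<open>U\<close> and \<open>V\<close>,
  then the path-component of \<open>x\<close> in \<open>U \<inter> V\<close> lies in both. Moreover, a map from an lpc-space \<open>Y\<close>
  that is continuous into \<open>X\<close> remains continuous into \<^term>\<open>lpc_topology X\<close>
  (\<open>continuous_map_into_lpc_topology\<close>), because it sends path-components of the preimage of
  an open set \<open>U\<close>, which are open in \<open>Y\<close>, into path-components of \<open>U\<close>.

  Applied to the unit interval, the second observation shows that both topologies have the same
  paths. So the basic open sets of \<^term>\<open>lpc_topology X\<close> are path-connected for the new topology,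
  which is therefore locally path-connected. Applied to an arbitrary \<open>Y\<close>, the same observation is
  the existence of lifts through the identity; their uniqueness is clear.

  For a second universal space \<open>p : L \<rightarrow> X\<close>, lifting the identity of \<^term>\<open>lpc_topology X\<close> gives
  a continuous section of \<open>p\<close>. The usual argument would show that the section is also a left inverse
  by testing \<open>L\<close> against itself. Here the test spaces have points in the type of \<open>X\<close>, whereas
  \<open>L\<close> may live on another type; testing against a one-point space shows instead that \<open>p\<close> is
  injective (\<open>universal_lpc_space_inj_on\<close>), and a section of an injective map is its inverse.
\<close>

section \<open>The topology generated by path-components of open sets\<close>

lemma path_component_of_subtopology_mono:
  assumes "U \<subseteq> V"
  shows "path_component_of_set (subtopology X U) x \<subseteq> path_component_of_set (subtopology X V) x"
  using path_component_of_mono[OF _ assms] by blast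

lemma openin_lpc_topology_path_component:
  assumes "openin X U"
  shows "openin (lpc_topology X) (path_component_of_set (subtopology X U) x)"
proof (cases "x \<in> topspace (subtopology X U)")
  case True
  then show ?thesis
    unfolding lpc_topology_def
    by (intro topology_generated_by_Basis)
      (use assms path_component_in_path_components_of[of "subtopology X U" x] in blast)
next
  case False
  then show ?thesis
    by (metis openin_empty path_component_of_eq_empty)
qed

lemma topspace_lpc_topology [simp]: "topspace (lpc_topology X) = topspace X"
proof -
  have "\<Union>(\<Union>U \<in> {U. openin X U}. path_components_of (subtopology X U))
        = (\<Union>U \<in> {U. openin X U}. topspace (subtopology X U))"
    by (simp add: Union_path_components_of[symmetric] del: topspace_subtopology) blast
  also have "\<dots> = topspace X"
    by auto
  finally show ?thesis
    by (simp add: lpc_topology_def)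
qed

text \<open>
  Closure of the right-hand side under binary intersections is the point: in \<open>U \<inter> V\<close> the
  path-component of \<open>x\<close> is at most as large as in \<open>U\<close> and in \<open>V\<close>.
\<close>

lemma openin_lpc_topology_iff:
  "openin (lpc_topology X) W \<longleftrightarrow>
     (\<forall>x\<in>W. \<exists>U. openin X U \<and> x \<in> U \<and> path_component_of_set (subtopology X U) x \<subseteq> W)"
  (is "_ \<longleftrightarrow> ?R W")
proof
  assume "openin (lpc_topology X) W"
  then have "generate_topology_on (\<Union>U \<in> {U. openin X U}. path_components_of (subtopology X U)) W"
    unfolding lpc_topology_def by (rule openin_topology_generated_by)
  then show "?R W"
  proof induction
    case (Int A B)
    show ?case
    proof
      fix x assume "x \<in> A \<inter> B"
      then obtain U V where "openin X U" "x \<in> U" "path_component_of_set (subtopology X U) x \<subseteq> A"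
        "openin X V" "x \<in> V" "path_component_of_set (subtopology X V) x \<subseteq> B"
        using Int.IH by (meson IntD1 IntD2)
      moreover have "path_component_of_set (subtopology X (U \<inter> V)) x
            \<subseteq> path_component_of_set (subtopology X U) x \<inter> path_component_of_set (subtopology X V) x"
        by (simp add: path_component_of_subtopology_mono)
      ultimately show "\<exists>U. openin X U \<and> x \<in> U \<and> path_component_of_set (subtopology X U) x \<subseteq> A \<inter> B"
        by (intro exI[of _ "U \<inter> V"]) blast
    qed
  next
    case (UN K)
    then show ?case
      by (meson Union_iff Union_upper subset_trans)
  next
    case (Basis C)
    then obtain U where U: "openin X U" "C \<in> path_components_of (subtopology X U)"
      by auto
    show ?case
    proof
      fix x assume "x \<in> C"
      then have "C = path_component_of_set (subtopology X U) x" "x \<in> U"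
        using U(2) path_component_of_equiv[of "subtopology X U"]
        by (auto simp: path_components_of_def)
      then show "\<exists>U. openin X U \<and> x \<in> U \<and> path_component_of_set (subtopology X U) x \<subseteq> C"
        using U(1) by blast
    qed
  qed simp
next
  assume R: "?R W"
  show "openin (lpc_topology X) W"
  proof (subst openin_subopen, intro ballI)
    fix x assume "x \<in> W"
    then obtain U where U: "openin X U" "x \<in> U" "path_component_of_set (subtopology X U) x \<subseteq> W"
      using R by blast
    moreover have "path_component_of (subtopology X U) x x"
      using U openin_subset by (fastforce simp: path_component_of_refl)
    ultimately show "\<exists>T. openin (lpc_topology X) T \<and> x \<in> T \<and> T \<subseteq> W"
      using openin_lpc_topology_path_component by (metis mem_Collect_eq)
  qed
qed

text \<open>An open set is the union of its path-components, so the new topology is finer.\<close>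

lemma continuous_map_id_lpc_topology: "continuous_map (lpc_topology X) X id"
proof -
  have "openin (lpc_topology X) U" if "openin X U" for U
    unfolding openin_lpc_topology_iff
  proof
    fix x assume "x \<in> U"
    moreover have "path_component_of_set (subtopology X U) x \<subseteq> U"
      using path_component_of_subset_topspace[of "subtopology X U" x] by auto
    ultimately show
      "\<exists>V. openin X V \<and> x \<in> V \<and> path_component_of_set (subtopology X V) x \<subseteq> U"
      using that by blast
  qed
  moreover have "{x \<in> topspace X. x \<in> U} = U" if "openin X U" for U
    using openin_subset[OF that] by blast
  ultimately show ?thesis
    by (simp add: continuous_map_def)
qed

section \<open>Lifting maps from lpc-spaces\<close>

text \<open>
  A basic neighbourhood of \<open>f y\<close> is its path-component in an open set \<open>U\<close>. The path-component of
  \<open>y\<close> in the preimage of \<open>U\<close> is an open neighbourhood of \<open>y\<close> because \<open>Y\<close> is an lpc-space, and its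
  image is path-connected within \<open>U\<close>, so it stays in that basic neighbourhood.
\<close>

lemma continuous_map_into_lpc_topology:
  assumes Y: "locally_path_connected_space Y" and f: "continuous_map Y X f"
  shows "continuous_map Y (lpc_topology X) f"
  unfolding continuous_map_def topspace_lpc_topology
proof (intro conjI allI impI)
  show "f \<in> topspace Y \<rightarrow> topspace X"
    using f by (simp add: continuous_map_def)
  fix W assume W: "openin (lpc_topology X) W"
  show "openin Y {y \<in> topspace Y. f y \<in> W}"
  proof (subst openin_subopen, intro ballI)
    fix y assume "y \<in> {y \<in> topspace Y. f y \<in> W}"
    then have y: "y \<in> topspace Y" "f y \<in> W"
      by auto
    then obtain U where U: "openin X U" "f y \<in> U"
        "path_component_of_set (subtopology X U) (f y) \<subseteq> W"
      using W unfolding openin_lpc_topology_iff by blast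
    define V where "V = {y \<in> topspace Y. f y \<in> U}"
    define C where "C = path_component_of_set (subtopology Y V) y"
    have V: "openin Y V" "y \<in> V"
      using f U y by (auto simp: V_def continuous_map_def)
    have "openin Y C"
      using Y V unfolding C_def locally_path_connected_space_eq_open_path_component_of by blast
    moreover have "y \<in> C"
      using V y by (simp add: C_def path_component_of_refl)
    moreover have "C \<subseteq> V"
      using path_component_of_subset_topspace[of "subtopology Y V" y] by (simp add: C_def)
    moreover have "f ` C \<subseteq> W"
    proof -
      have "continuous_map (subtopology Y V) (subtopology X U) f"
        using f by (auto simp: V_def continuous_map_in_subtopology continuous_map_from_subtopology)
      then have "path_connectedin (subtopology X U) (f ` C)"
        unfolding C_def
        by (rule path_connectedin_continuous_map_image[OF _ path_connectedin_path_component_of])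
      then have "f ` C \<subseteq> path_component_of_set (subtopology X U) (f y)"
        using \<open>y \<in> C\<close> by (intro path_component_of_maximal) auto
      then show ?thesis
        using U by blast
    qed
    ultimately show "\<exists>T. openin Y T \<and> y \<in> T \<and> T \<subseteq> {y \<in> topspace Y. f y \<in> W}"
      by (intro exI[of _ C]) (auto simp: V_def)
  qed
qed

section \<open>Local path-connectedness of the new topology\<close>

lemma locally_path_connected_space_convex:
  fixes S :: "'a::real_normed_vector set"
  assumes "convex S"
  shows "locally_path_connected_space (top_of_set S)"
  unfolding locally_path_connected_space
proof (intro allI impI)
  fix W x assume "openin (top_of_set S) W \<and> x \<in> W"
  then obtain e where e: "0 < e" "ball x e \<inter> S \<subseteq> W" and x: "x \<in> S"
    by (meson openin_contains_ball subsetD)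
  moreover have "path_connectedin (top_of_set S) (ball x e \<inter> S)"
    using assms by (simp add: path_connectedin_subtopology convex_Int convex_imp_path_connected)
  moreover have "openin (top_of_set S) (ball x e \<inter> S)"
    by (metis inf_commute open_ball openin_open_Int)
  ultimately show
    "\<exists>U. openin (top_of_set S) U \<and> path_connectedin (top_of_set S) U \<and> x \<in> U \<and> U \<subseteq> W"
    by (intro exI[of _ "ball x e \<inter> S"]) auto
qed

text \<open>The unit interval is an lpc-space, so every path in \<open>X\<close> lifts.\<close>

lemma pathin_lpc_topology: "pathin X g \<Longrightarrow> pathin (lpc_topology X) g"
  unfolding pathin_def
  by (intro continuous_map_into_lpc_topology locally_path_connected_space_convex) auto

lemma path_connectedin_lpc_topology:
  "path_connectedin X S \<Longrightarrow> path_connectedin (lpc_topology X) S"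
  unfolding path_connectedin topspace_lpc_topology using pathin_lpc_topology by metis

lemma locally_path_connected_space_lpc_topology: "locally_path_connected_space (lpc_topology X)"
  unfolding locally_path_connected_space
proof (intro allI impI)
  fix W x assume W: "openin (lpc_topology X) W \<and> x \<in> W"
  then obtain U where U: "openin X U" "x \<in> U" "path_component_of_set (subtopology X U) x \<subseteq> W"
    unfolding openin_lpc_topology_iff by blast
  let ?C = "path_component_of_set (subtopology X U) x"
  have "path_connectedin X ?C"
    using path_connectedin_path_component_of[of "subtopology X U" x]
    by (simp only: path_connectedin_subtopology)
  then have "path_connectedin (lpc_topology X) ?C"
    by (rule path_connectedin_lpc_topology)
  moreover have "x \<in> ?C"
    using U openin_subset by (fastforce simp: path_component_of_refl)
  ultimately show
    "\<exists>V. openin (lpc_topology X) V \<and> path_connectedin (lpc_topology X) V \<and> x \<in> V \<and> V \<subseteq> W"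
    using U(3) openin_lpc_topology_path_component[OF U(1)] by (intro exI[of _ ?C]) simp
qed

section \<open>Universality and uniqueness\<close>

lemma universal_lpc_space_lpc_topology:
  "universal_lpc_space TYPE('b) X (lpc_topology X) id"
  unfolding universal_lpc_space_def
proof (intro conjI allI impI)
  fix Y :: "'b topology" and f
  assume "locally_path_connected_space Y \<and> continuous_map Y X f"
  then have "continuous_map Y (lpc_topology X) f"
    by (simp add: continuous_map_into_lpc_topology)
  then have "continuous_map Y (lpc_topology X) (restrict f (topspace Y))"
    by (rule continuous_map_eq) simp
  then show "\<exists>!g. g \<in> extensional (topspace Y) \<and> continuous_map Y (lpc_topology X) g \<and>
        (\<forall>y\<in>topspace Y. id (g y) = f y)"
    by (intro ex1I[of _ "restrict f (topspace Y)"]) (auto intro: extensionalityI)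
qed (simp_all add: locally_path_connected_space_lpc_topology continuous_map_id_lpc_topology)

text \<open>Two points with the same image are two lifts of the same map from a one-point space.\<close>

lemma universal_lpc_space_inj_on:
  assumes "universal_lpc_space TYPE('b) X L p"
  shows "inj_on p (topspace L)"
proof
  fix u v assume uv: "u \<in> topspace L" "v \<in> topspace L" "p u = p v"
  define pt :: 'b where "pt = undefined"
  let ?Y = "discrete_topology {pt}"
  have "p u \<in> topspace X"
    using assms uv by (auto simp: universal_lpc_space_def continuous_map_def)
  then have "locally_path_connected_space ?Y \<and> continuous_map ?Y X (\<lambda>_. p u)"
    by (simp add: locally_path_connected_space_discrete_topology)
  moreover have "locally_path_connected_space ?Y \<and> continuous_map ?Y X (\<lambda>_. p u) \<longrightarrow>
      (\<exists>!g. g \<in> extensional (topspace ?Y) \<and> continuous_map ?Y L g \<and>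
        (\<forall>y\<in>topspace ?Y. p (g y) = p u))"
    using assms unfolding universal_lpc_space_def by (elim conjE allE)
  ultimately have "\<exists>!g. g \<in> extensional (topspace ?Y) \<and> continuous_map ?Y L g \<and>
      (\<forall>y\<in>topspace ?Y. p (g y) = p u)"
    by (rule rev_mp)
  moreover have "(\<lambda>y\<in>{pt}. w) \<in> extensional (topspace ?Y) \<and> continuous_map ?Y L (\<lambda>y\<in>{pt}. w) \<and>
      (\<forall>y\<in>topspace ?Y. p ((\<lambda>y\<in>{pt}. w) y) = p u)" if "w \<in> {u, v}" for w
    using uv that by auto
  ultimately have "(\<lambda>y\<in>{pt}. u) = (\<lambda>y\<in>{pt}. v)"
    by (metis (no_types, lifting) insertCI)
  then show "u = v"
    by (metis restrict_apply' singletonI)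
qed

lemma universal_lpc_space_homeomorphic:
  fixes X :: "'a topology"
  assumes univ: "universal_lpc_space TYPE('a) X L p"
  shows "L homeomorphic_space lpc_topology X"
proof -
  have p: "continuous_map L (lpc_topology X) p"
    using univ by (simp add: universal_lpc_space_def continuous_map_into_lpc_topology)
  obtain s where s: "continuous_map (lpc_topology X) L s"
      and ps: "\<And>x. x \<in> topspace X \<Longrightarrow> p (s x) = x"
    using univ locally_path_connected_space_lpc_topology[of X] continuous_map_id_lpc_topology[of X]
    unfolding universal_lpc_space_def by (metis id_apply topspace_lpc_topology)
  have "s (p u) = u" if "u \<in> topspace L" for u
  proof (rule inj_onD[OF universal_lpc_space_inj_on[OF univ]])
    have "p u \<in> topspace X"
      using p that by (auto simp: continuous_map_def)
    then show "p (s (p u)) = p u" "s (p u) \<in> topspace L"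
      using s ps by (auto simp: continuous_map_def)
  qed (fact that)
  then have "homeomorphic_maps L (lpc_topology X) p s"
    using p s ps by (simp add: homeomorphic_maps_def)
  then show ?thesis
    by (auto simp: homeomorphic_space_def)
qed

theorem theorem2p2:
  fixes X :: "'a topology"
  shows "universal_lpc_space TYPE('b) X (lpc_topology X) id \<and>
         (\<forall>(L :: 'c topology) p.
            universal_lpc_space TYPE('a) X L p \<longrightarrow> L homeomorphic_space lpc_topology X)"
  by (simp add: universal_lpc_space_lpc_topology universal_lpc_space_homeomorphic)

end
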